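(* Let $\varepsilon \in (0,1)$. Let $X_1, X_2, \ldots$ be a sequence of i.i.d. Bernoulli random variables on a probability space $(\Omega, \mathscr{F}, \Pr)$ with $\Pr\{X_i = 1\} = p \in (0,1)$ and $\Pr\{X_i = 0\} = 1-p$ for every positive integer $i$. Let $\gamma$ be a positive integer, let $\boldsymbol{n}$ be the random variable $\boldsymbol{n}(\omega) = \min\{ n \in \mathbb{Z} : \sum_{i=1}^n X_i(\omega) = \gamma \}$, and define $\widetilde{\boldsymbol{p}} = \frac{\gamma}{\boldsymbol{n}}$. Then $$\Pr\left\{ \left| \frac{\widetilde{\boldsymbol{p}} - p}{p} \right| \ge \varepsilon \right\} \le \mathscr{Q}(\varepsilon,\gamma), \quad\text{where}\quad \mathscr{Q}(\varepsilon,\gamma) = (1+\varepsilon)^{-\gamma}\exp\left(\frac{\varepsilon\gamma}{1+\varepsilon}\right) + (1-\varepsilon)^{-\gamma}\exp\left(-\frac{\varepsilon\gamma}{1-\varepsilon}\right),$$ and $\mathscr{Q}(\varepsilon,\gamma)$ is monotone decreasing with respect to $\gamma$. Moreover, for any $\delta \in (0,1)$ there exists a unique number $\gamma^*$ such that $\mathscr{Q}(\varepsilon,\gamma^* ) = \delta$, and $$\max\left\{ \frac{(1+\varepsilon)\ln\frac{1}{\delta}}{(1+\varepsilon)\ln(1+\varepsilon)-\varepsilon},\ \frac{(1-\varepsilon)\ln\frac{2}{\delta}}{(1-\varepsilon)\ln(1-\varepsilon)+\varepsilon} \right\} < \gamma^* < \widetilde{\gamma} < \frac{(1+\varepsilon)\ln\frac{2}{\delta}}{(1+\varepsilon)\ln(1+\varepsilon)-\varepsilon}.$$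 Furthermore, $$\Pr\left\{ \boldsymbol{n} \ge \frac{\gamma(1+\varrho)}{p} \right\} \le \left(\frac{1-p}{1-p+\varrho}\right)^{(1-p+\varrho)\frac{\gamma}{p}} (1+\varrho)^{(1+\varrho)\frac{\gamma}{p}}, \qquad \varrho > 0,$$ and $$\Pr\left\{ \boldsymbol{n} \le \frac{\gamma(1-\varrho)}{p} \right\} \le \left(\frac{1-p}{1-p-\varrho}\right)^{(1-p-\varrho)\frac{\gamma}{p}} (1-\varrho)^{(1-\varrho)\frac{\gamma}{p}}, \qquad 0 < \varrho < 1-p.$$
   Context: For $\varepsilon,\delta\in(0,1)$, $\widetilde{\gamma}$ denotes the unique real number $\widetilde{\gamma} > \frac{1-\varepsilon}{\varepsilon}$ with $\widetilde{\mathscr{Q}}(\varepsilon,\widetilde{\gamma}) = \delta$, where, for real $\gamma > \frac{1-\varepsilon}{\varepsilon}$, $$\widetilde{\mathscr{Q}}(\varepsilon,\gamma) = (1+\varepsilon)^{-\gamma} \exp\left(\frac{\varepsilon\gamma}{1+\varepsilon}\right) + \left(\frac{\gamma - 1 + \varepsilon}{\gamma - \varepsilon\gamma}\right)^{\gamma} \exp\left(\frac{1 - \varepsilon\gamma - \varepsilon}{1-\varepsilon}\right).$$ (Such a number exists and is unique because $\widetilde{\mathscr{Q}}(\varepsilon,\cdot)$ is decreasing on $\left(\frac{1-\varepsilon}{\varepsilon},\infty\right)$, tends to $0$ at infinity, and has limit greater than $1$ at the left endpoint.) In the statements about monotonicity and about $\gamma^*$, $\mathscr{Q}(\varepsilon,\cdot)$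 is regarded as a function of a real variable $\gamma$; the number $\gamma^*$ is real and need not be an integer. *)

theory Defs
  imports "HOL-Probability.Probability"
begin

definition Q :: "real \<Rightarrow> real \<Rightarrow> real" where
  "Q \<epsilon> \<gamma> =
     (1 + \<epsilon>) powr (- \<gamma>) * exp (\<epsilon> * \<gamma> / (1 + \<epsilon>))
   + (1 - \<epsilon>) powr (- \<gamma>) * exp (- (\<epsilon> * \<gamma> / (1 - \<epsilon>)))"

definition Q_tilde :: "real \<Rightarrow> real \<Rightarrow> real" where
  "Q_tilde \<epsilon> \<gamma> =
     (1 + \<epsilon>) powr (- \<gamma>) * exp (\<epsilon> * \<gamma> / (1 + \<epsilon>))
   + ((\<gamma> - 1 + \<epsilon>) / (\<gamma> - \<epsilon> * \<gamma>)) powr \<gamma> * exp ((1 - \<epsilon> * \<gamma> - \<epsilon>) / (1 - \<epsilon>))"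

definition gamma_tilde :: "real \<Rightarrow> real \<Rightarrow> real" where
  "gamma_tilde \<epsilon> \<delta> = (THE \<gamma>. \<gamma> > (1 - \<epsilon>) / \<epsilon> \<and> Q_tilde \<epsilon> \<gamma> = \<delta>)"

(* If the sum never equals \<gamma> (a null event for Bernoulli samples), the infimum of
   the empty set makes the sample size infinite. *)
definition sample_size :: "(nat \<Rightarrow> 'a \<Rightarrow> real) \<Rightarrow> nat \<Rightarrow> 'a \<Rightarrow> enat" where
  "sample_size X \<gamma> \<omega> = Inf (enat ` {n. (\<Sum>i=1..n. X i \<omega>) = real \<gamma>})"

definition p_tilde :: "(nat \<Rightarrow> 'a \<Rightarrow> real) \<Rightarrow> nat \<Rightarrow> 'a \<Rightarrow> real" where
  "p_tilde X \<gamma> \<omega> = (case sample_size X \<gamma> \<omega> of enat n \<Rightarrow> real \<gamma> / real n | \<infinity> \<Rightarrow> 0)"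

end

theory Submission
  imports Defs
begin

text \<open>
  Up to null events, the sample size is at least (at most) \<open>m\<close> exactly when a partial sum with about \<open>m\<close>
  terms is below (at least) \<open>\<gamma>\<close>, and Markov's inequality for \<open>t powr S\<^sub>k\<close> bounds both tails by
  \<open>t powr (- \<gamma>) * (1 + p * (t - 1)) powr m\<close>. The optimal \<open>t\<close> gives the two tail bounds, and
  \<open>t = 1 \<plusminus> \<epsilon>\<close> together with \<open>1 + x \<le> exp x\<close> gives \<open>Q\<close>.

  With \<open>rate x = ln (1 + x) - x / (1 + x)\<close> one has
  \<open>Q \<epsilon> \<gamma> = exp (- rate \<epsilon> * \<gamma>) + exp (- rate (- \<epsilon>) * \<gamma>)\<close> with \<open>0 < rate \<epsilon> < rate (- \<epsilon>)\<close>, which gives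
  the lower bounds. \<open>Q_tilde\<close> has the same first summand and a larger second one, and at
  \<open>\<gamma> = ln (2 / \<delta>) / rate \<epsilon>\<close>, where the first summand is \<open>\<delta> / 2\<close>, the second one is still smaller, because
  \<open>rate (- \<epsilon>) - rate \<epsilon> \<ge> 4 / 3 * \<epsilon> ^ 3\<close> and \<open>rate \<epsilon> \<le> \<epsilon>\<^sup>2 / 2\<close>.
\<close>

section \<open>Analysis of the bounding functions\<close>

definition rate :: "real \<Rightarrow> real" where
  "rate x = ln (1 + x) - x / (1 + x)"

lemma rate_0 [simp]: "rate 0 = 0"
  by (simp add: rate_def)

lemma rate_nonneg:
  assumes "x > -1" shows "rate x \<ge> 0"
proof -
  have "ln (1 / (1 + x)) \<le> 1 / (1 + x) - 1"
    using assms by (intro ln_le_minus_one) auto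
  then show ?thesis using assms by (simp add: rate_def ln_div field_simps)
qed

lemma DERIV_rate:
  assumes "x > -1" shows "(rate has_real_derivative x / (1 + x)\<^sup>2) (at x)"
proof -
  have "(rate has_real_derivative 1 / (1 + x) - ((1 + x) - x) / ((1 + x) * (1 + x))) (at x)"
    unfolding rate_def[abs_def] using assms
    by (auto intro!: derivative_eq_intros)
  moreover have "1 / (1 + x) - ((1 + x) - x) / ((1 + x) * (1 + x)) = x / (1 + x)\<^sup>2"
    using assms by (simp add: divide_simps power2_eq_square)
  ultimately show ?thesis by simp
qed

lemma DERIV_rate_minus:
  assumes "x < 1" shows "((\<lambda>x. rate (- x)) has_real_derivative x / (1 - x)\<^sup>2) (at x)"
proof -
  have "(uminus has_real_derivative -1) (at x)"
    by (auto intro!: derivative_eq_intros)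
  then have "((\<lambda>x. rate (- x)) has_real_derivative - x / (1 + - x)\<^sup>2 * - 1) (at x)"
    using assms by (intro DERIV_chain2[where f = rate and g = uminus] DERIV_rate) auto
  then show ?thesis by simp
qed

lemma rate_minus_strict_mono:
  assumes "0 \<le> x" "x < y" "y < 1"
  shows "rate (- x) < rate (- y)"
proof (rule DERIV_pos_imp_increasing_open[OF assms(2), where f = "\<lambda>x. rate (- x)"])
  fix z assume "x < z" "z < y"
  then show "\<exists>d. ((\<lambda>x. rate (- x)) has_real_derivative d) (at z) \<and> 0 < d"
    using assms DERIV_rate_minus[of z] by (intro exI[of _ "z / (1 - z)\<^sup>2"]) auto
next
  show "continuous_on {x..y} (\<lambda>x. rate (- x))"
    using assms by (intro continuous_at_imp_continuous_on ballI DERIV_isCont[OF DERIV_rate_minus]) auto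
qed

text \<open>Integrating \<open>z / (1 + z)\<^sup>2 \<le> z\<close> from 0. The estimate serves to
  bound \<open>gamma_upper\<close> from below.\<close>

lemma rate_le_square:
  assumes "0 \<le> x" shows "rate x \<le> x\<^sup>2 / 2"
proof -
  have "0\<^sup>2 / 2 - rate 0 \<le> x\<^sup>2 / 2 - rate x"
  proof (rule DERIV_nonneg_imp_nondecreasing[OF assms])
    fix z :: real assume z: "0 \<le> z" "z \<le> x"
    have "((\<lambda>x. x\<^sup>2 / 2 - rate x) has_real_derivative z - z / (1 + z)\<^sup>2) (at z)"
      using z by (auto intro!: derivative_eq_intros DERIV_rate)
    moreover have "z / (1 + z)\<^sup>2 \<le> z"
      using z by (simp add: divide_le_eq mult_le_cancel_left1)
    ultimately show "\<exists>d. ((\<lambda>x. x\<^sup>2 / 2 - rate x) has_real_derivative d) (at z) \<and> 0 \<le> d"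
      by force
  qed
  then show ?thesis by simp
qed

text \<open>The two derivatives differ by
  \<open>4 * z\<^sup>2 / (1 - z\<^sup>2)\<^sup>2 \<ge> 4 * z\<^sup>2\<close>; integrating from 0
  gives the cubic. This quantitative gap is later weighed against the correction term in
  \<open>Q_tilde\<close>.\<close>

lemma rate_minus_diff_ge:
  assumes "0 \<le> x" "x < 1" shows "rate (- x) - rate x \<ge> 4 / 3 * x ^ 3"
proof -
  have "rate (- 0) - rate 0 - 4 / 3 * 0 ^ 3 \<le> rate (- x) - rate x - 4 / 3 * x ^ 3"
  proof (rule DERIV_nonneg_imp_nondecreasing[OF assms(1)])
    fix z :: real assume z: "0 \<le> z" "z \<le> x"
    have "((\<lambda>x. rate (- x) - rate x - 4 / 3 * x ^ 3) has_real_derivative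
        z / (1 - z)\<^sup>2 - z / (1 + z)\<^sup>2 - 4 * z\<^sup>2) (at z)"
      using z assms by (auto intro!: derivative_eq_intros DERIV_rate DERIV_rate_minus)
    moreover have "z / (1 - z)\<^sup>2 - z / (1 + z)\<^sup>2 = 4 * z\<^sup>2 / (1 - z\<^sup>2)\<^sup>2"
    proof -
      have "(1 - z\<^sup>2)\<^sup>2 = (1 - z)\<^sup>2 * (1 + z)\<^sup>2"
        by (simp add: power2_eq_square algebra_simps)
      moreover have "z / (1 - z)\<^sup>2 - z / (1 + z)\<^sup>2
          = (z * (1 + z)\<^sup>2 - z * (1 - z)\<^sup>2) / ((1 - z)\<^sup>2 * (1 + z)\<^sup>2)"
        using z assms by (subst diff_frac_eq) auto
      moreover have "z * (1 + z)\<^sup>2 - z * (1 - z)\<^sup>2 = 4 * z\<^sup>2"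
        by (simp add: power2_eq_square algebra_simps)
      ultimately show ?thesis by simp
    qed
    moreover have "4 * z\<^sup>2 \<le> 4 * z\<^sup>2 / (1 - z\<^sup>2)\<^sup>2"
    proof -
      have "0 < 1 - z\<^sup>2" "1 - z\<^sup>2 \<le> 1"
        using z assms by (auto simp: power_less_one_iff abs_square_less_1)
      then have "0 < (1 - z\<^sup>2)\<^sup>2" "(1 - z\<^sup>2)\<^sup>2 \<le> 1"
        by (auto intro: power_le_one)
      then show ?thesis by (simp add: le_divide_eq mult_left_le)
    qed
    ultimately show "\<exists>d. ((\<lambda>x. rate (- x) - rate x - 4 / 3 * x ^ 3) has_real_derivative d) (at z) \<and> 0 \<le> d"
      by force
  qed
  then show ?thesis by simp
qed

lemma rate_pos:
  assumes "0 < x" "x < 1" shows "rate x > 0"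
proof -
  have "rate 0 < rate x"
  proof (rule DERIV_pos_imp_increasing_open[OF assms(1)])
    fix z assume "0 < z" "z < x"
    then show "\<exists>d. (rate has_real_derivative d) (at z) \<and> 0 < d"
      by (intro exI[of _ "z / (1 + z)\<^sup>2"] conjI DERIV_rate) auto
  next
    show "continuous_on {0..x} rate"
      by (intro continuous_at_imp_continuous_on ballI DERIV_isCont[OF DERIV_rate]) auto
  qed
  then show ?thesis by simp
qed

lemma rate_less_rate_minus:
  assumes "0 < x" "x < 1" shows "rate x < rate (- x)"
  using rate_minus_diff_ge[of x] assms zero_less_power[of x 3] by linarith

section \<open>The bound \<open>Q\<close> and the location of its level points\<close>

lemma Q_eq:
  assumes "0 < \<epsilon>" "\<epsilon> < 1"
  shows "Q \<epsilon> g = exp (- (rate \<epsilon> * g)) + exp (- (rate (- \<epsilon>) * g))"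
  using assms by (simp add: Q_def rate_def powr_def algebra_simps flip: exp_add)

lemma Q_strict_antimono:
  assumes "0 < \<epsilon>" "\<epsilon> < 1"
  shows "strict_antimono_on UNIV (Q \<epsilon>)"
proof (rule monotone_onI)
  fix x y :: real assume "x < y"
  then have "rate \<epsilon> * x < rate \<epsilon> * y" "rate (- \<epsilon>) * x < rate (- \<epsilon>) * y"
    using rate_pos[OF assms] rate_less_rate_minus[OF assms] by auto
  then show "Q \<epsilon> x > Q \<epsilon> y"
    unfolding Q_eq[OF assms] by (intro add_strict_mono) simp_all
qed

lemma Q_less_iff:
  assumes "0 < \<epsilon>" "\<epsilon> < 1"
  shows "Q \<epsilon> x < Q \<epsilon> y \<longleftrightarrow> y < x"
  using monotone_onD[OF Q_strict_antimono[OF assms], of x y]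
    monotone_onD[OF Q_strict_antimono[OF assms], of y x]
  by (cases x y rule: linorder_cases) auto

lemma Q_inj:
  assumes "0 < \<epsilon>" "\<epsilon> < 1" "Q \<epsilon> x = Q \<epsilon> y"
  shows "x = y"
  using Q_less_iff[OF assms(1,2)] assms(3) by (metis linorder_neqE_linordered_idom order_less_irrefl)

text \<open>The point at which the common first summand of \<open>Q\<close> and
  \<open>Q_tilde\<close> equals \<open>\<delta> / 2\<close>; by \<open>divide_rate\<close> it is the
  upper bound in the theorem.\<close>

definition gamma_upper :: "real \<Rightarrow> real \<Rightarrow> real" where
  "gamma_upper \<epsilon> \<delta> = ln (2 / \<delta>) / rate \<epsilon>"

lemma Q_gamma_upper_less:
  assumes "0 < \<epsilon>" "\<epsilon> < 1" "0 < \<delta>" "\<delta> < 1"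
  shows "Q \<epsilon> (gamma_upper \<epsilon> \<delta>) < \<delta>"
proof -
  have "gamma_upper \<epsilon> \<delta> > 0"
    using assms rate_pos[of \<epsilon>] by (simp add: gamma_upper_def)
  then have "rate \<epsilon> * gamma_upper \<epsilon> \<delta> < rate (- \<epsilon>) * gamma_upper \<epsilon> \<delta>"
    using rate_less_rate_minus[OF assms(1,2)] by simp
  moreover have "rate \<epsilon> * gamma_upper \<epsilon> \<delta> = ln (2 / \<delta>)"
    using rate_pos[of \<epsilon>] assms by (simp add: gamma_upper_def)
  moreover have "exp (- ln (2 / \<delta>)) = \<delta> / 2"
    using assms by (simp add: exp_minus)
  ultimately show ?thesis
    using assms by (smt (verit) Q_eq exp_less_cancel_iff field_sum_of_halves)
qed

text \<open>Intermediate value theorem between 0, where \<open>Q\<close> is 2, and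
  \<open>gamma_upper\<close>. Uniqueness ranges over all reals because \<open>Q\<close> decreases on
  the whole line.\<close>

lemma ex1_Q_eq:
  assumes "0 < \<epsilon>" "\<epsilon> < 1" "0 < \<delta>" "\<delta> < 1"
  shows "\<exists>!g. Q \<epsilon> g = \<delta>"
proof -
  have "gamma_upper \<epsilon> \<delta> > 0"
    using assms rate_pos[of \<epsilon>] by (simp add: gamma_upper_def)
  moreover have "continuous_on {0..gamma_upper \<epsilon> \<delta>} (Q \<epsilon>)"
    unfolding Q_eq[OF assms(1,2)] by (intro continuous_intros)
  moreover have "Q \<epsilon> 0 > \<delta>" using assms by (simp add: Q_eq)
  ultimately obtain g where "Q \<epsilon> g = \<delta>"
    using IVT2'[of "Q \<epsilon>" "gamma_upper \<epsilon> \<delta>" \<delta> 0] Q_gamma_upper_less[OF assms] by force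
  then show ?thesis using Q_inj assms by blast
qed

text \<open>Each summand is bounded separately: the first is below \<delta> since the second is
  positive, and the second, being the smaller of the two, is below
  \<open>\<delta> / 2\<close>.\<close>

lemma Q_eq_lower_bounds:
  assumes "0 < \<epsilon>" "\<epsilon> < 1" "0 < \<delta>" "\<delta> < 1" "Q \<epsilon> g = \<delta>"
  shows "ln (1 / \<delta>) / rate \<epsilon> < g" "ln (2 / \<delta>) / rate (- \<epsilon>) < g"
proof -
  have r: "0 < rate \<epsilon>" "rate \<epsilon> < rate (- \<epsilon>)"
    using rate_pos rate_less_rate_minus assms by auto
  have d: "exp (- (rate \<epsilon> * g)) + exp (- (rate (- \<epsilon>) * g)) = \<delta>"
    using assms by (simp add: Q_eq)
  \<comment> \<open>Since \<delta> lies below the value at 0, \<open>g\<close> is positive, so the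
    larger rate gives the smaller summand.\<close>
  have "Q \<epsilon> 0 = 2" using assms by (simp add: Q_eq)
  then have "g > 0" using Q_less_iff[of \<epsilon> g 0] assms by simp
  then have "exp (- (rate (- \<epsilon>) * g)) < exp (- (rate \<epsilon> * g))" using r by simp
  then have "exp (- (rate \<epsilon> * g)) < \<delta>" "exp (- (rate (- \<epsilon>) * g)) < \<delta> / 2"
    using d exp_gt_zero[of "- (rate (- \<epsilon>) * g)"] by linarith+
  then have "- (rate \<epsilon> * g) < ln \<delta>" "- (rate (- \<epsilon>) * g) < ln (\<delta> / 2)"
    using assms by (metis exp_less_cancel_iff exp_ln half_gt_zero)+
  then have "ln (1 / \<delta>) < g * rate \<epsilon>" "ln (2 / \<delta>) < g * rate (- \<epsilon>)"
    using assms by (simp_all add: ln_div mult.commute[of g])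
  then show "ln (1 / \<delta>) / rate \<epsilon> < g" "ln (2 / \<delta>) / rate (- \<epsilon>) < g"
    using r by (simp_all only: pos_divide_less_eq)
qed

section \<open>The modified bound \<open>Q_tilde\<close> and its level point
  \<open>gamma_tilde\<close>\<close>

definition log_tail :: "real \<Rightarrow> real \<Rightarrow> real" where
  "log_tail \<epsilon> g = g * ln (1 - (1 - \<epsilon>) / g) + 1 - rate (- \<epsilon>) * g"

text \<open>\<open>log_tail\<close> is the logarithm of the second summand; it differs from the
  exponent \<open>- (rate (- \<epsilon>) * g)\<close> in \<open>Q\<close> by the correction
  \<open>g * ln (1 - (1 - \<epsilon>) / g) + 1\<close>. The left endpoint is included so that the
  intermediate value theorem can start there.\<close>

lemma Q_tilde_eq:
  assumes "0 < \<epsilon>" "\<epsilon> < 1" "g \<ge> (1 - \<epsilon>) / \<epsilon>"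
  shows "Q_tilde \<epsilon> g = exp (- (rate \<epsilon> * g)) + exp (log_tail \<epsilon> g)"
proof -
  have "(1 - \<epsilon>) / \<epsilon> > 1 - \<epsilon>"
    using assms by (simp add: less_divide_eq)
  then have g: "g > 1 - \<epsilon>" "g > 0" using assms by linarith+
  have "(g - 1 + \<epsilon>) / (g - \<epsilon> * g) = (1 - (1 - \<epsilon>) / g) / (1 - \<epsilon>)"
  proof -
    have "1 - (1 - \<epsilon>) / g = (g - 1 + \<epsilon>) / g" using g by (simp add: diff_divide_distrib add_divide_distrib)
    moreover have "g - \<epsilon> * g = g * (1 - \<epsilon>)" by (simp add: algebra_simps)
    ultimately show ?thesis by simp
  qed
  moreover have "1 - (1 - \<epsilon>) / g > 0" using g by (simp add: divide_less_eq)
  moreover have "(1 - \<epsilon> * g - \<epsilon>) / (1 - \<epsilon>) = 1 - \<epsilon> * g / (1 - \<epsilon>)"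
    using assms by (simp add: field_simps)
  moreover have "1 - (1 - \<epsilon>) / g \<noteq> 0" "(1 - (1 - \<epsilon>) / g) / (1 - \<epsilon>) \<noteq> 0"
    using calculation(2) assms by auto
  moreover have "exp (- g * ln (1 + \<epsilon>)) * exp (\<epsilon> * g / (1 + \<epsilon>)) = exp (- (rate \<epsilon> * g))"
    by (simp add: rate_def algebra_simps flip: exp_add)
  moreover have "g * (ln (1 - (1 - \<epsilon>) / g) - ln (1 - \<epsilon>)) + (1 - \<epsilon> * g / (1 - \<epsilon>)) = log_tail \<epsilon> g"
    by (simp add: rate_def log_tail_def algebra_simps)
  ultimately show ?thesis
    using assms by (simp add: Q_tilde_def powr_def ln_div flip: exp_add)
qed

text \<open>With \<open>x = (1 - \<epsilon>) / g\<close>, the derivative of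
  \<open>g * ln (1 - x)\<close> is \<open>ln (1 - x) + x / (1 - x)\<close>, which is again a value
  of \<open>rate\<close>.\<close>

lemma DERIV_log_tail:
  assumes "0 < \<epsilon>" "\<epsilon> < 1" "g > 1 - \<epsilon>"
  shows "(log_tail \<epsilon> has_real_derivative rate (- ((1 - \<epsilon>) / g)) - rate (- \<epsilon>)) (at g)"
proof -
  have "1 - (1 - \<epsilon>) / g > 0" using assms by (simp add: divide_less_eq)
  then have "(log_tail \<epsilon> has_real_derivative
      ln (1 - (1 - \<epsilon>) / g) + g * (((1 - \<epsilon>) / g\<^sup>2) / (1 - (1 - \<epsilon>) / g)) - rate (- \<epsilon>)) (at g)"
    unfolding log_tail_def[abs_def] using assms
    by (auto intro!: derivative_eq_intros simp: power2_eq_square divide_inverse)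
  moreover have "g * (((1 - \<epsilon>) / g\<^sup>2) / (1 - (1 - \<epsilon>) / g)) = ((1 - \<epsilon>) / g) / (1 - (1 - \<epsilon>) / g)"
    using assms by (simp add: power2_eq_square)
  ultimately show ?thesis by (simp add: rate_def)
qed

text \<open>To the right of the endpoint \<open>(1 - \<epsilon>) / z < \<epsilon>\<close>, so
  monotonicity of \<open>rate (- x)\<close> makes the derivative negative.\<close>

lemma log_tail_strict_antimono:
  assumes "0 < \<epsilon>" "\<epsilon> < 1" "(1 - \<epsilon>) / \<epsilon> \<le> g" "g < h"
  shows "log_tail \<epsilon> h < log_tail \<epsilon> g"
proof (rule DERIV_neg_imp_decreasing_open[OF assms(4)])
  have "(1 - \<epsilon>) / \<epsilon> > 1 - \<epsilon>"
    using assms by (simp add: less_divide_eq)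
  then have g: "g > 1 - \<epsilon>" using assms by linarith
  {
    fix z assume z: "g < z" "z < h"
    then have "z > (1 - \<epsilon>) / \<epsilon>" using assms by linarith
    then have "(1 - \<epsilon>) / z < \<epsilon>" using assms z g by (simp add: field_simps)
    then have "rate (- ((1 - \<epsilon>) / z)) < rate (- \<epsilon>)"
      using assms z g by (intro rate_minus_strict_mono) auto
    then show "\<exists>d. (log_tail \<epsilon> has_real_derivative d) (at z) \<and> d < 0"
      using DERIV_log_tail[of \<epsilon> z] assms z g by force
  }
  show "continuous_on {g..h} (log_tail \<epsilon>)"
    using assms g by (intro continuous_at_imp_continuous_on ballI DERIV_isCont[OF DERIV_log_tail]) auto
qed

lemma Q_tilde_strict_antimono:
  assumes "0 < \<epsilon>" "\<epsilon> < 1" "(1 - \<epsilon>) / \<epsilon> \<le> g" "g < h"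
  shows "Q_tilde \<epsilon> h < Q_tilde \<epsilon> g"
  using log_tail_strict_antimono[OF assms] assms rate_pos[OF assms(1,2)]
  by (simp add: Q_tilde_eq add_strict_mono)

text \<open>The correction in \<open>log_tail\<close> is positive:
  \<open>g * ln (1 - x) \<ge> - (g * x) / (1 - x)\<close>, where
  \<open>g * x = 1 - \<epsilon>\<close> and \<open>x < \<epsilon>\<close>, so the right side exceeds
  -1.\<close>

lemma Q_less_Q_tilde:
  assumes "0 < \<epsilon>" "\<epsilon> < 1" "(1 - \<epsilon>) / \<epsilon> < g"
  shows "Q \<epsilon> g < Q_tilde \<epsilon> g"
proof -
  define x where "x = (1 - \<epsilon>) / g"
  have "0 < (1 - \<epsilon>) / \<epsilon>" using assms by simp
  then have g: "g > 0" using assms by linarith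
  have x: "x < \<epsilon>" "0 < x" using g assms by (simp_all add: x_def field_simps)
  have "ln (1 - x) \<ge> - (x / (1 - x))"
    using rate_nonneg[of "- x"] x assms by (simp add: rate_def)
  then have "g * ln (1 - x) \<ge> g * - (x / (1 - x))" using g by (intro mult_left_mono) auto
  moreover have "g * - (x / (1 - x)) = - ((1 - \<epsilon>) / (1 - x))" using g by (simp add: x_def)
  moreover have "(1 - \<epsilon>) / (1 - x) < 1" using x assms by (simp add: divide_less_eq)
  ultimately have "g * ln (1 - x) > -1" by linarith
  then have "- (rate (- \<epsilon>) * g) < log_tail \<epsilon> g" by (simp add: log_tail_def x_def)
  then show ?thesis using assms by (simp add: Q_eq Q_tilde_eq)
qed

text \<open>The numerator exceeds 1/2, because
  \<open>ln (\<delta> / 2) \<le> \<delta> / 2 - 1 < - 1 / 2\<close>, and the denominator is at most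
  \<open>\<epsilon>\<^sup>2 / 2\<close>.\<close>

lemma gamma_upper_ge:
  assumes "0 < \<epsilon>" "\<epsilon> < 1" "0 < \<delta>" "\<delta> < 1"
  shows "gamma_upper \<epsilon> \<delta> \<ge> 1 / \<epsilon>\<^sup>2"
proof -
  have "ln (\<delta> / 2) \<le> \<delta> / 2 - 1" using assms by (intro ln_le_minus_one) auto
  then have l: "ln (2 / \<delta>) > 1 / 2" using assms by (simp add: ln_div)
  have "1 / \<epsilon>\<^sup>2 = (1 / 2) / (\<epsilon>\<^sup>2 / 2)" by simp
  also have "\<dots> \<le> ln (2 / \<delta>) / rate \<epsilon>"
    using l assms rate_pos[of \<epsilon>] rate_le_square[of \<epsilon>] by (intro frac_le) auto
  finally show ?thesis by (simp add: gamma_upper_def)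
qed

lemma gamma_upper_gt_domain:
  assumes "0 < \<epsilon>" "\<epsilon> < 1" "0 < \<delta>" "\<delta> < 1"
  shows "gamma_upper \<epsilon> \<delta> > (1 - \<epsilon>) / \<epsilon>"
proof -
  have "(1 - \<epsilon>) / \<epsilon> < 1 / \<epsilon>" using assms by (simp add: divide_strict_right_mono)
  also have "1 / \<epsilon> \<le> 1 / \<epsilon>\<^sup>2" using assms by (simp add: field_simps power2_eq_square)
  finally show ?thesis using gamma_upper_ge[OF assms] by simp
qed

text \<open>The first summand is \<open>\<delta> / 2\<close>, so \<open>log_tail\<close> must fall
  below \<open>- (rate \<epsilon> * U)\<close>. The inequality \<open>ln y \<le> y - 1\<close>
  bounds the correction by \<epsilon>, which leaves
  \<open>\<epsilon> < (rate (- \<epsilon>) - rate \<epsilon>) * U\<close>.\<close>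

lemma Q_tilde_gamma_upper_less:
  assumes "0 < \<epsilon>" "\<epsilon> < 1" "0 < \<delta>" "\<delta> < 1"
  shows "Q_tilde \<epsilon> (gamma_upper \<epsilon> \<delta>) < \<delta>"
proof -
  define U where "U = gamma_upper \<epsilon> \<delta>"
  have U: "U > (1 - \<epsilon>) / \<epsilon>" "U \<ge> 1 / \<epsilon>\<^sup>2"
    unfolding U_def using gamma_upper_gt_domain gamma_upper_ge assms by auto
  have "(1 - \<epsilon>) / \<epsilon> > 1 - \<epsilon>" using assms by (simp add: less_divide_eq)
  then have U1: "U > 1 - \<epsilon>" "U > 0" using U assms by linarith+
  have "ln (1 - (1 - \<epsilon>) / U) \<le> (1 - (1 - \<epsilon>) / U) - 1"
    using U1 by (intro ln_le_minus_one) (simp add: divide_less_eq)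
  then have "U * ln (1 - (1 - \<epsilon>) / U) \<le> U * (- ((1 - \<epsilon>) / U))"
    using U1 by (intro mult_left_mono) auto
  then have "log_tail \<epsilon> U \<le> \<epsilon> - rate (- \<epsilon>) * U"
    using U1 by (simp add: log_tail_def)
  moreover have "\<epsilon> < (rate (- \<epsilon>) - rate \<epsilon>) * U"
  proof -
    \<comment> \<open>The gap of order \<open>\<epsilon> ^ 3\<close> times
      \<open>U \<ge> 1 / \<epsilon>\<^sup>2\<close> is at least \<open>4 / 3 * \<epsilon>\<close>;
      strictness comes from 4/3 > 1.\<close>
    have "\<epsilon> < (4 / 3 * \<epsilon> ^ 3) * (1 / \<epsilon>\<^sup>2)"
      using assms by (simp add: power2_eq_square power3_eq_cube)
    also have "\<dots> \<le> (rate (- \<epsilon>) - rate \<epsilon>) * U"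
      using U assms rate_minus_diff_ge[of \<epsilon>] rate_less_rate_minus[of \<epsilon>]
      by (intro mult_mono) auto
    finally show ?thesis .
  qed
  ultimately have "log_tail \<epsilon> U < - (rate \<epsilon> * U)" by (simp add: algebra_simps)
  moreover have "exp (- (rate \<epsilon> * U)) = \<delta> / 2"
    using rate_pos[of \<epsilon>] assms by (simp add: U_def gamma_upper_def exp_minus)
  ultimately have "exp (log_tail \<epsilon> U) < \<delta> / 2" by (metis exp_less_mono)
  with \<open>exp (- (rate \<epsilon> * U)) = \<delta> / 2\<close> show ?thesis
    using U assms Q_tilde_eq[of \<epsilon> U] unfolding U_def by simp
qed

text \<open>At the endpoint \<open>(1 - \<epsilon>) / g = \<epsilon>\<close>, the terms of
  \<open>log_tail\<close> cancel and the second summand is exactly 1.\<close>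

lemma Q_tilde_left_endpoint:
  assumes "0 < \<epsilon>" "\<epsilon> < 1"
  shows "Q_tilde \<epsilon> ((1 - \<epsilon>) / \<epsilon>) > 1"
proof -
  have "log_tail \<epsilon> ((1 - \<epsilon>) / \<epsilon>) = 0"
  proof -
    have "1 - (1 - \<epsilon>) / ((1 - \<epsilon>) / \<epsilon>) = 1 - \<epsilon>" using assms by simp
    moreover have "(1 - \<epsilon>) / \<epsilon> * (ln (1 - \<epsilon>) + \<epsilon> / (1 - \<epsilon>)) = (1 - \<epsilon>) / \<epsilon> * ln (1 - \<epsilon>) + 1"
      using assms by (simp add: ring_distribs)
    ultimately show ?thesis
      by (simp only: log_tail_def rate_def) (simp add: algebra_simps)
  qed
  then show ?thesis using assms by (simp add: Q_tilde_eq)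
qed

text \<open>Existence by the intermediate value theorem up to \<open>gamma_upper\<close> and
  uniqueness by strict monotonicity justify the definite description.\<close>

lemma gamma_tilde_properties:
  assumes "0 < \<epsilon>" "\<epsilon> < 1" "0 < \<delta>" "\<delta> < 1"
  shows "gamma_tilde \<epsilon> \<delta> > (1 - \<epsilon>) / \<epsilon>" "Q_tilde \<epsilon> (gamma_tilde \<epsilon> \<delta>) = \<delta>"
proof -
  let ?P = "\<lambda>g. g > (1 - \<epsilon>) / \<epsilon> \<and> Q_tilde \<epsilon> g = \<delta>"
  let ?l = "(1 - \<epsilon>) / \<epsilon>" and ?U = "gamma_upper \<epsilon> \<delta>"
  have l: "?l > 1 - \<epsilon>" using assms by (simp add: less_divide_eq)
  have "continuous_on {?l..?U} (log_tail \<epsilon>)"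
    using assms l by (intro continuous_at_imp_continuous_on ballI DERIV_isCont[OF DERIV_log_tail]) auto
  then have "continuous_on {?l..?U} (\<lambda>g. exp (- (rate \<epsilon> * g)) + exp (log_tail \<epsilon> g))"
    by (intro continuous_intros)
  then have "continuous_on {?l..?U} (Q_tilde \<epsilon>)"
    by (rule continuous_on_eq) (use assms Q_tilde_eq in auto)
  then obtain g where g: "g \<ge> ?l" "Q_tilde \<epsilon> g = \<delta>"
    using IVT2'[of "Q_tilde \<epsilon>" ?U \<delta> ?l] Q_tilde_gamma_upper_less[OF assms]
      Q_tilde_left_endpoint[OF assms(1,2)] gamma_upper_gt_domain[OF assms] assms by force
  \<comment> \<open>The value at the endpoint exceeds 1, hence \<delta>, so the solution lies in the
    open domain.\<close>
  moreover have "g \<noteq> ?l" using g Q_tilde_left_endpoint[OF assms(1,2)] assms by auto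
  ultimately have "?P g" by simp
  moreover have "h = g" if "?P h" for h
    using Q_tilde_strict_antimono[OF assms(1,2), of g h] Q_tilde_strict_antimono[OF assms(1,2), of h g]
      that \<open>?P g\<close> by (cases g h rule: linorder_cases) auto
  ultimately have "?P (gamma_tilde \<epsilon> \<delta>)"
    unfolding gamma_tilde_def by (rule theI)
  then show "gamma_tilde \<epsilon> \<delta> > ?l" "Q_tilde \<epsilon> (gamma_tilde \<epsilon> \<delta>) = \<delta>" by auto
qed

lemma gamma_tilde_less_gamma_upper:
  assumes "0 < \<epsilon>" "\<epsilon> < 1" "0 < \<delta>" "\<delta> < 1"
  shows "gamma_tilde \<epsilon> \<delta> < gamma_upper \<epsilon> \<delta>"
proof (rule ccontr)
  assume "\<not> ?thesis"
  then have "Q_tilde \<epsilon> (gamma_tilde \<epsilon> \<delta>) \<le> Q_tilde \<epsilon> (gamma_upper \<epsilon> \<delta>)"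
    using Q_tilde_strict_antimono[OF assms(1,2), of "gamma_upper \<epsilon> \<delta>" "gamma_tilde \<epsilon> \<delta>"]
      gamma_upper_gt_domain[OF assms] by (cases "gamma_tilde \<epsilon> \<delta> = gamma_upper \<epsilon> \<delta>") auto
  then show False
    using Q_tilde_gamma_upper_less[OF assms] gamma_tilde_properties(2)[OF assms] by simp
qed

text \<open>At \<open>gamma_tilde\<close> the smaller function \<open>Q\<close> is already below
  \<delta>, so its own level point lies further left.\<close>

lemma less_gamma_tilde:
  assumes "0 < \<epsilon>" "\<epsilon> < 1" "0 < \<delta>" "\<delta> < 1" "Q \<epsilon> g = \<delta>"
  shows "g < gamma_tilde \<epsilon> \<delta>"
  using Q_less_Q_tilde[of \<epsilon> "gamma_tilde \<epsilon> \<delta>"] gamma_tilde_properties[OF assms(1-4)]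
    Q_less_iff[of \<epsilon> "gamma_tilde \<epsilon> \<delta>" g] assms by simp

text \<open>Brings all the bounds on the level points into the form stated in the theorem, with
  \<open>x = \<epsilon>\<close> or \<open>x = - \<epsilon>\<close>.\<close>

lemma divide_rate:
  assumes "x > -1"
  shows "(1 + x) * c / ((1 + x) * ln (1 + x) - x) = c / rate x"
proof -
  have "(1 + x) * ln (1 + x) - x = (1 + x) * rate x"
    using assms by (simp add: rate_def right_diff_distrib)
  then show ?thesis using assms by simp
qed

section \<open>Tail bounds for the sample size\<close>

locale bernoulli_sequence = prob_space M for M :: "'a measure" +
  fixes X :: "nat \<Rightarrow> 'a \<Rightarrow> real" and p :: real
  assumes indep: "indep_vars (\<lambda>_. borel) X {1..}"
    and p: "0 < p" "p < 1"
    and prob_1: "\<And>i. i \<ge> 1 \<Longrightarrow> \<P>(\<omega> in M. X i \<omega> = 1) = p"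
    and prob_0: "\<And>i. i \<ge> 1 \<Longrightarrow> \<P>(\<omega> in M. X i \<omega> = 0) = 1 - p"
begin

section \<open>Exponential moments of the partial sums\<close>

lemma measurable_X [measurable]:
  assumes "i \<ge> 1" shows "X i \<in> borel_measurable M"
  using indep assms by (auto simp: indep_vars_def)

definition partial_sum :: "nat \<Rightarrow> 'a \<Rightarrow> real" where
  "partial_sum n \<omega> = (\<Sum>i=1..n. X i \<omega>)"

lemma measurable_partial_sum [measurable]: "partial_sum n \<in> borel_measurable M"
  unfolding partial_sum_def[abs_def] by (intro borel_measurable_sum measurable_X) auto

text \<open>The two point probabilities add up to 1; countably many null sets are discarded
  together.\<close>

lemma AE_X_01: "AE \<omega> in M. \<forall>i\<ge>1. X i \<omega> = 0 \<or> X i \<omega> = 1"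
proof -
  have "AE \<omega> in M. X i \<omega> = 0 \<or> X i \<omega> = 1" if i: "i \<ge> 1" for i
  proof -
    note [measurable] = measurable_X[OF i]
    have "\<P>(\<omega> in M. X i \<omega> = 0 \<or> X i \<omega> = 1) =
        \<P>(\<omega> in M. X i \<omega> = 0) + \<P>(\<omega> in M. X i \<omega> = 1)"
      by (subst finite_measure_Union[symmetric]) (auto intro!: arg_cong[where f = prob])
    then show ?thesis
      using prob_0[OF i] prob_1[OF i] by (subst prob_Collect_eq_1[symmetric]) auto
  qed
  then show ?thesis by (simp add: AE_all_countable)
qed

text \<open>Almost surely \<open>t powr partial_sum n\<close> is a product of \<open>n\<close>
  independent factors, each of mean \<open>1 - p + p * t\<close>.\<close>

lemma expectation_powr_partial_sum:
  assumes "t > 0"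
  shows "integrable M (\<lambda>\<omega>. t powr partial_sum n \<omega>)"
    and "expectation (\<lambda>\<omega>. t powr partial_sum n \<omega>) = (1 + p * (t - 1)) ^ n"
proof -
  \<comment> \<open>\<open>Y i\<close> agrees with \<open>t powr X i\<close> where
    \<open>X i\<close> is 0 or 1, and takes only the values 1 and \<open>t\<close> everywhere, so it
    is integrable.\<close>
  define Y where "Y i \<omega> = 1 + (t - 1) * indicator {1} (X i \<omega>)" for i \<omega>
  have Y: "integrable M (Y i)" "expectation (Y i) = 1 + p * (t - 1)" if i: "i \<ge> 1" for i
  proof -
    note [measurable] = measurable_X[OF i]
    have "indicator {1} (X i \<omega>) = (indicator {\<omega>\<in>space M. X i \<omega> = 1} \<omega> :: real)"
      if "\<omega> \<in> space M" for \<omega>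
      using that by (auto simp: indicator_def)
    then have "integrable M (\<lambda>\<omega>. indicator {1} (X i \<omega>) :: real)"
      "expectation (\<lambda>\<omega>. indicator {1} (X i \<omega>)) = p"
      using prob_1[OF i] by (simp_all cong: Bochner_Integration.integrable_cong Bochner_Integration.integral_cong add: less_top[symmetric])
    then show "integrable M (Y i)" "expectation (Y i) = 1 + p * (t - 1)"
      by (simp_all add: Y_def[abs_def] prob_space)
  qed
  have "indep_vars (\<lambda>_. borel) (\<lambda>i. (\<lambda>x. 1 + (t - 1) * indicator {1} x) \<circ> X i) {1..n}"
    by (intro indep_vars_compose[where M' = "\<lambda>_. borel"] indep_vars_subset[OF indep]) auto
  then have ind: "indep_vars (\<lambda>_. borel) Y {1..n}"
    by (simp add: Y_def[abs_def] comp_def)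
  have int: "integrable M (\<lambda>\<omega>. \<Prod>i\<in>{1..n}. Y i \<omega>)"
    by (intro indep_vars_integrable ind Y) auto
  have "expectation (\<lambda>\<omega>. \<Prod>i\<in>{1..n}. Y i \<omega>) = (\<Prod>i\<in>{1..n}. expectation (Y i))"
    by (intro indep_vars_lebesgue_integral ind Y) auto
  also have "\<dots> = (1 + p * (t - 1)) ^ n" using Y by simp
  finally have exp: "expectation (\<lambda>\<omega>. \<Prod>i\<in>{1..n}. Y i \<omega>) = (1 + p * (t - 1)) ^ n" .
  have AE: "AE \<omega> in M. (\<Prod>i\<in>{1..n}. Y i \<omega>) = t powr partial_sum n \<omega>"
    using AE_X_01
  proof eventually_elim
    fix \<omega> assume *: "\<forall>i\<ge>1. X i \<omega> = 0 \<or> X i \<omega> = 1"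
    have "t powr partial_sum n \<omega> = (\<Prod>i\<in>{1..n}. t powr X i \<omega>)"
      using assms by (simp add: partial_sum_def powr_sum)
    also have "\<dots> = (\<Prod>i\<in>{1..n}. Y i \<omega>)"
      using * assms by (intro prod.cong) (auto simp: Y_def indicator_def)
    finally show "(\<Prod>i\<in>{1..n}. Y i \<omega>) = t powr partial_sum n \<omega>" ..
  qed
  show "integrable M (\<lambda>\<omega>. t powr partial_sum n \<omega>)"
    using int by (rule integrable_cong_AE_imp) (use AE in auto)
  show "expectation (\<lambda>\<omega>. t powr partial_sum n \<omega>) = (1 + p * (t - 1)) ^ n"
    unfolding exp[symmetric] using int AE
    by (intro integral_cong_AE) auto
qed

text \<open>The event is stated for the power because its meaning for the sum depends on the side of
  1 on which \<open>t\<close> lies: \<open>t < 1\<close> gives the lower tail, \<open>t > 1\<close>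
  the upper.\<close>

lemma prob_powr_partial_sum_ge:
  assumes "t > 0"
  shows "\<P>(\<omega> in M. t powr partial_sum n \<omega> \<ge> t powr c) \<le> t powr (- c) * (1 + p * (t - 1)) ^ n"
proof -
  have "\<P>(\<omega> in M. t powr partial_sum n \<omega> \<ge> t powr c)
      \<le> expectation (\<lambda>\<omega>. t powr partial_sum n \<omega>) / t powr c"
    using assms by (intro integral_Markov_inequality_measure[where A = "{}"] expectation_powr_partial_sum) auto
  then show ?thesis
    using assms by (simp add: expectation_powr_partial_sum powr_minus divide_inverse mult.commute)
qed

section \<open>Paths of the partial sums and the sample size\<close>

lemma partial_sum_0 [simp]: "partial_sum 0 \<omega> = 0"
  by (simp add: partial_sum_def)

lemma partial_sum_Suc: "partial_sum (Suc n) \<omega> = partial_sum n \<omega> + X (Suc n) \<omega>"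
  by (simp add: partial_sum_def)

lemma partial_sum_mono:
  assumes "\<forall>i\<ge>1. X i \<omega> = 0 \<or> X i \<omega> = 1" "m \<le> n"
  shows "partial_sum m \<omega> \<le> partial_sum n \<omega>"
  unfolding partial_sum_def
proof (intro sum_mono2)
  fix i assume "i \<in> {1..n} - {1..m}"
  then have "X i \<omega> = 0 \<or> X i \<omega> = 1" using assms(1) by simp
  then show "X i \<omega> \<ge> 0" by auto
qed (use assms(2) in auto)

text \<open>The sums start at 0 and move by 0 or 1 through the integers, so they cannot jump over
  \<gamma>.\<close>

lemma partial_sum_hits:
  assumes "\<forall>i\<ge>1. X i \<omega> = 0 \<or> X i \<omega> = 1" "partial_sum n \<omega> > real \<gamma> - 1"
  shows "\<exists>j\<le>n. partial_sum j \<omega> = real \<gamma>"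
  using assms(2)
proof (induction n)
  case (Suc n)
  consider "X (Suc n) \<omega> = 0" | "X (Suc n) \<omega> = 1" using assms(1) by force
  then show ?case
  proof cases
    case 1
    then show ?thesis using Suc by (auto simp: partial_sum_Suc intro: le_SucI)
  next
    case 2
    have "partial_sum n \<omega> \<in> \<int>" 
      unfolding partial_sum_def by (intro Ints_sum) (use assms(1) in force)
    then obtain z where z: "partial_sum n \<omega> = of_int z" by (auto elim: Ints_cases)
    show ?thesis
    proof (cases "partial_sum n \<omega> > real \<gamma> - 1")
      case True
      then show ?thesis using Suc.IH le_SucI by blast
    next
      case False
      \<comment> \<open>A unit step crosses \<gamma> - 1 here, so the integer before the step is
        exactly \<gamma> - 1.\<close>
      then have "of_int z > real \<gamma> - 2" "of_int z \<le> real \<gamma> - 1"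
        using Suc.prems 2 z by (auto simp: partial_sum_Suc)
      then have "z = int \<gamma> - 1" by linarith
      then have "partial_sum (Suc n) \<omega> = real \<gamma>" using 2 z by (simp add: partial_sum_Suc)
      then show ?thesis by blast
    qed
  qed
qed auto

lemma sample_size_leI:
  "partial_sum n \<omega> = real \<gamma> \<Longrightarrow> sample_size X \<gamma> \<omega> \<le> enat n"
  unfolding sample_size_def partial_sum_def by (intro Inf_lower) auto

text \<open>A finite infimum comes from a nonempty set, and well-ordering makes it a
  minimum.\<close>

lemma sample_size_attained:
  assumes "sample_size X \<gamma> \<omega> = enat n"
  shows "partial_sum n \<omega> = real \<gamma>"
proof -
  let ?A = "enat ` {n. partial_sum n \<omega> = real \<gamma>}"
  have A: "sample_size X \<gamma> \<omega> = Inf ?A" by (simp add: sample_size_def partial_sum_def)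
  have "?A \<noteq> {}"
  proof
    assume "?A = {}"
    then show False using A assms by (simp add: Inf_enat_def)
  qed
  then have "Inf ?A \<in> ?A" by (meson ex_in_conv wellorder_InfI)
  then show ?thesis using A assms by auto
qed

text \<open>The index \<open>nat \<lceil>m\<rceil> - 1\<close> is the largest natural number below
  \<open>m\<close>; a sum above \<gamma> - 1 there would have hit \<gamma> earlier than
  \<open>m\<close>. Positivity of \<open>m\<close> keeps the subtraction from being
  truncated.\<close>

lemma AE_partial_sum_le_if_sample_size_ge:
  assumes "m > 0"
  shows "AE \<omega> in M. ereal_of_enat (sample_size X \<gamma> \<omega>) \<ge> ereal m \<longrightarrow>
     partial_sum (nat \<lceil>m\<rceil> - 1) \<omega> \<le> real \<gamma> - 1"
  using AE_X_01
proof eventually_elim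
  fix \<omega> assume *: "\<forall>i\<ge>1. X i \<omega> = 0 \<or> X i \<omega> = 1"
  show "ereal m \<le> ereal_of_enat (sample_size X \<gamma> \<omega>) \<longrightarrow>
     partial_sum (nat \<lceil>m\<rceil> - 1) \<omega> \<le> real \<gamma> - 1"
  proof (rule impI, rule ccontr)
    assume m: "ereal m \<le> ereal_of_enat (sample_size X \<gamma> \<omega>)"
      and "\<not> partial_sum (nat \<lceil>m\<rceil> - 1) \<omega> \<le> real \<gamma> - 1"
    then obtain j where j: "j \<le> nat \<lceil>m\<rceil> - 1" "partial_sum j \<omega> = real \<gamma>"
      using partial_sum_hits[OF *, of \<gamma> "nat \<lceil>m\<rceil> - 1"] by (meson not_le)
    have "ereal m \<le> ereal_of_enat (enat j)"
      using m sample_size_leI[OF j(2)] by (meson ereal_of_enat_le_iff order_trans)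
    then have "m \<le> real j" by simp
    moreover have "real j < m" using j(1) assms by linarith
    ultimately show False by simp
  qed
qed

text \<open>The sum equals \<gamma> at the sample size, which is finite here, and does not decrease
  afterwards.\<close>

lemma AE_partial_sum_ge_if_sample_size_le:
  "AE \<omega> in M. ereal_of_enat (sample_size X \<gamma> \<omega>) \<le> ereal m \<longrightarrow>
     partial_sum (nat \<lfloor>m\<rfloor>) \<omega> \<ge> real \<gamma>"
  using AE_X_01
proof eventually_elim
  fix \<omega> assume *: "\<forall>i\<ge>1. X i \<omega> = 0 \<or> X i \<omega> = 1"
  show "ereal_of_enat (sample_size X \<gamma> \<omega>) \<le> ereal m \<longrightarrow>
     partial_sum (nat \<lfloor>m\<rfloor>) \<omega> \<ge> real \<gamma>"
  proof
    assume m: "ereal_of_enat (sample_size X \<gamma> \<omega>) \<le> ereal m"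
    then obtain n where n: "sample_size X \<gamma> \<omega> = enat n"
      by (cases "sample_size X \<gamma> \<omega>") auto
    then have "real n \<le> m" using m by simp
    then have "n \<le> nat \<lfloor>m\<rfloor>" by (simp add: le_nat_floor)
    then show "partial_sum (nat \<lfloor>m\<rfloor>) \<omega> \<ge> real \<gamma>"
      using partial_sum_mono[OF *] sample_size_attained[OF n] by metis
  qed
qed

section \<open>Chernoff bounds for the partial sums and the sample size\<close>

lemma prob_partial_sum_le:
  assumes "0 < t" "t \<le> 1" "m > 0"
  shows "\<P>(\<omega> in M. partial_sum (nat \<lceil>m\<rceil> - 1) \<omega> \<le> real \<gamma> - 1)
     \<le> t powr (- real \<gamma>) * (1 + p * (t - 1)) powr m"
proof -
  define k where "k = nat \<lceil>m\<rceil> - 1"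
  define s where "s = 1 + p * (t - 1)"
  have k: "real k + 1 \<ge> m" unfolding k_def using assms(3) by linarith
  \<comment> \<open>\<open>s\<close> is a convex combination of 1 and \<open>t\<close>, hence
    between them.\<close>
  have "p * (1 - t) \<le> 1 * (1 - t)" using p assms by (intro mult_right_mono) auto
  then have s: "t \<le> s" "s \<le> 1" "s > 0"
    using assms p by (auto simp: s_def algebra_simps mult_le_cancel_left1)
  have "{\<omega>\<in>space M. partial_sum k \<omega> \<le> real \<gamma> - 1}
      \<subseteq> {\<omega>\<in>space M. t powr partial_sum k \<omega> \<ge> t powr (real \<gamma> - 1)}"
    using assms by (auto intro: powr_mono')
  then have "\<P>(\<omega> in M. partial_sum k \<omega> \<le> real \<gamma> - 1)
      \<le> \<P>(\<omega> in M. t powr partial_sum k \<omega> \<ge> t powr (real \<gamma> - 1))"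
    by (intro finite_measure_mono) auto
  also have "\<dots> \<le> t powr (- (real \<gamma> - 1)) * s ^ k"
    unfolding s_def by (rule prob_powr_partial_sum_ge) fact
  also have "\<dots> = t powr (- real \<gamma>) * (t * s ^ k)"
    using assms by (simp add: powr_diff powr_minus field_simps)
  \<comment> \<open>The level \<gamma> - 1 leaves a spare factor \<open>t\<close>; replacing it by
    \<open>s\<close> supplies the power missing from \<open>k\<close>, which may be as small as
    \<open>m - 1\<close>.\<close>
  also have "\<dots> \<le> t powr (- real \<gamma>) * (s * s ^ k)"
    using s by (intro mult_left_mono mult_right_mono) auto
  also have "s * s ^ k = s powr (real k + 1)"
    using s by (simp add: powr_add powr_realpow)
  \<comment> \<open>As \<open>s \<le> 1\<close>, lowering the exponent from \<open>k + 1\<close> to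
    \<open>m\<close> can only enlarge the power.\<close>
  also have "t powr (- real \<gamma>) * \<dots> \<le> t powr (- real \<gamma>) * s powr m"
    using s k by (intro mult_left_mono powr_mono') auto
  finally show ?thesis by (simp add: k_def s_def)
qed

text \<open>Here \<open>s \<ge> 1\<close> and \<open>k \<le> m\<close>, so passing from
  \<open>k\<close> to \<open>m\<close> only weakens the bound.\<close>

lemma prob_partial_sum_ge:
  assumes "t \<ge> 1" "m \<ge> 0"
  shows "\<P>(\<omega> in M. partial_sum (nat \<lfloor>m\<rfloor>) \<omega> \<ge> real \<gamma>)
     \<le> t powr (- real \<gamma>) * (1 + p * (t - 1)) powr m"
proof -
  define k where "k = nat \<lfloor>m\<rfloor>"
  define s where "s = 1 + p * (t - 1)"
  have k: "real k \<le> m" unfolding k_def using assms(2) by linarith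
  have s: "s \<ge> 1" using assms p by (auto simp: s_def)
  have "{\<omega>\<in>space M. partial_sum k \<omega> \<ge> real \<gamma>}
      \<subseteq> {\<omega>\<in>space M. t powr partial_sum k \<omega> \<ge> t powr real \<gamma>}"
    using assms by (auto intro: powr_mono)
  then have "\<P>(\<omega> in M. partial_sum k \<omega> \<ge> real \<gamma>)
      \<le> \<P>(\<omega> in M. t powr partial_sum k \<omega> \<ge> t powr real \<gamma>)"
    by (intro finite_measure_mono) auto
  also have "\<dots> \<le> t powr (- real \<gamma>) * s ^ k"
    unfolding s_def using assms by (intro prob_powr_partial_sum_ge) auto
  also have "s ^ k = s powr real k"
    using s by (simp add: powr_realpow)
  also have "t powr (- real \<gamma>) * \<dots> \<le> t powr (- real \<gamma>) * s powr m"
    using s k by (intro mult_left_mono powr_mono) auto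
  finally show ?thesis by (simp add: k_def s_def)
qed

lemma prob_sample_size_ge:
  assumes "0 < t" "t \<le> 1" "m > 0"
  shows "\<P>(\<omega> in M. ereal_of_enat (sample_size X \<gamma> \<omega>) \<ge> ereal m)
     \<le> t powr (- real \<gamma>) * (1 + p * (t - 1)) powr m"
proof -
  have "\<P>(\<omega> in M. ereal_of_enat (sample_size X \<gamma> \<omega>) \<ge> ereal m)
      \<le> \<P>(\<omega> in M. partial_sum (nat \<lceil>m\<rceil> - 1) \<omega> \<le> real \<gamma> - 1)"
    \<comment> \<open>Almost sure inclusion suffices, with measurability required of the larger
      event only.\<close>
    using AE_partial_sum_le_if_sample_size_ge[OF assms(3), of \<gamma>]
    by (intro finite_measure_mono_AE) (elim eventually_mono, auto)
  with prob_partial_sum_le[OF assms] show ?thesis by (rule order_trans[rotated])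
qed

lemma prob_sample_size_le:
  assumes "t \<ge> 1" "m \<ge> 0"
  shows "\<P>(\<omega> in M. ereal_of_enat (sample_size X \<gamma> \<omega>) \<le> ereal m)
     \<le> t powr (- real \<gamma>) * (1 + p * (t - 1)) powr m"
proof -
  have "\<P>(\<omega> in M. ereal_of_enat (sample_size X \<gamma> \<omega>) \<le> ereal m)
      \<le> \<P>(\<omega> in M. partial_sum (nat \<lfloor>m\<rfloor>) \<omega> \<ge> real \<gamma>)"
    using AE_partial_sum_ge_if_sample_size_le[of \<gamma> m]
    by (intro finite_measure_mono_AE) (elim eventually_mono, auto)
  with prob_partial_sum_ge[OF assms] show ?thesis by (rule order_trans[rotated])
qed

text \<open>The value of \<open>t\<close> is the minimizer of the Chernoff bound for the threshold \<open>m\<close>.\<close>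

lemma optimal_tilt:
  fixes \<gamma> :: nat
  assumes "r > p - 1"
  defines "t \<equiv> (1 - p) / (1 - p + r)" and "m \<equiv> real \<gamma> * (1 + r) / p"
  shows "t powr (- real \<gamma>) * (1 + p * (t - 1)) powr m =
    t powr ((1 - p + r) * (real \<gamma> / p)) * (1 + r) powr ((1 + r) * (real \<gamma> / p))"
proof -
  have t: "t > 0" using assms p by simp
  \<comment> \<open>The bound becomes \<open>t powr (m - \<gamma>) * (1 + r) powr m\<close>; both
    signs of \<open>r\<close> are covered, one for each tail.\<close>
  have "1 + p * (t - 1) = t * (1 + r)"
    using assms by (simp add: t_def field_simps)
  moreover have "(1 - p + r) * (real \<gamma> / p) = - real \<gamma> + m"
    using p by (simp add: m_def field_simps)
  moreover have "(1 + r) * (real \<gamma> / p) = m" by (simp add: m_def)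
  moreover have "(t * (1 + r)) powr m = t powr m * (1 + r) powr m"
    by (rule powr_mult)
  ultimately show ?thesis by (simp only: powr_add mult.assoc)
qed

text \<open>Raising \<open>1 + x \<le> exp x\<close> with \<open>x = p * (t - 1)\<close> to the
  power \<open>m\<close> leaves only the product \<open>p * m\<close>, which frees the bound from
  \<open>p\<close>.\<close>

lemma exp_tilt:
  assumes "t > 0" "m \<ge> 0" "p * m = c"
  shows "t powr (- real \<gamma>) * (1 + p * (t - 1)) powr m \<le> t powr (- real \<gamma>) * exp ((t - 1) * c)"
proof -
  have "0 < (1 - p) + p * t" using p assms by (intro add_pos_pos) auto
  then have "1 + p * (t - 1) > 0" by (simp add: algebra_simps)
  then have "(1 + p * (t - 1)) powr m \<le> exp (p * (t - 1)) powr m"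
    using assms by (intro powr_mono2) (auto intro: exp_ge_add_one_self)
  also have "\<dots> = exp ((t - 1) * c)"
    using assms(3) by (simp add: powr_def algebra_simps flip: assms(3))
  finally show ?thesis by (intro mult_left_mono) auto
qed

section \<open>The relative error of the estimator\<close>

lemma sample_size_of_relative_error:
  assumes "0 < \<epsilon>" "\<epsilon> < 1" "\<gamma> > 0" "\<bar>(p_tilde X \<gamma> \<omega> - p) / p\<bar> \<ge> \<epsilon>"
  shows "ereal_of_enat (sample_size X \<gamma> \<omega>) \<le> ereal (real \<gamma> / ((1 + \<epsilon>) * p))
       \<or> ereal_of_enat (sample_size X \<gamma> \<omega>) \<ge> ereal (real \<gamma> / ((1 - \<epsilon>) * p))"
proof (cases "sample_size X \<gamma> \<omega>")
  case (enat n)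
  \<comment> \<open>The empty sum is 0, not \<gamma>, so the quotient \<open>\<gamma> / n\<close> is
    genuine.\<close>
  then have "n \<noteq> 0" using sample_size_attained[OF enat] assms(3) by (metis partial_sum_0 of_nat_eq_0_iff less_irrefl)
  have "\<epsilon> * p \<le> \<bar>real \<gamma> / real n - p\<bar>"
    using assms(4) enat p by (simp add: p_tilde_def abs_divide le_divide_eq)
  \<comment> \<open>Overestimating \<open>p\<close> means stopping early, underestimating it means
    stopping late.\<close>
  then consider "(1 + \<epsilon>) * p \<le> real \<gamma> / real n" | "real \<gamma> / real n \<le> (1 - \<epsilon>) * p"
    by (force simp: algebra_simps abs_if split: if_splits)
  then show ?thesis
  proof cases
    case 1
    then have "real n \<le> real \<gamma> / ((1 + \<epsilon>) * p)"
      using \<open>n \<noteq> 0\<close> p assms by (simp add: le_divide_eq mult.commute)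
    then show ?thesis using enat by simp
  next
    case 2
    then have "real n \<ge> real \<gamma> / ((1 - \<epsilon>) * p)"
      using \<open>n \<noteq> 0\<close> p assms by (simp add: divide_le_eq mult.commute)
    then show ?thesis using enat by simp
  qed
\<comment> \<open>An infinite sample size satisfies the second alternative.\<close>
qed simp

text \<open>The thresholds satisfy \<open>p * m1 = \<gamma> / (1 + \<epsilon>)\<close> and
  \<open>p * m2 = \<gamma> / (1 - \<epsilon>)\<close>, so \<open>exp_tilt\<close> with
  \<open>t = 1 + \<epsilon>\<close> and \<open>t = 1 - \<epsilon>\<close> yields exactly the two
  summands of \<open>Q\<close>.\<close>

lemma prob_relative_error:
  assumes "0 < \<epsilon>" "\<epsilon> < 1" "\<gamma> > 0"
  shows "\<P>(\<omega> in M. \<bar>(p_tilde X \<gamma> \<omega> - p) / p\<bar> \<ge> \<epsilon>) \<le> Q \<epsilon> (real \<gamma>)"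
proof -
  define m1 where "m1 = real \<gamma> / ((1 + \<epsilon>) * p)"
  define m2 where "m2 = real \<gamma> / ((1 - \<epsilon>) * p)"
  have m: "m1 \<ge> 0" "m2 > 0" "p * m1 = real \<gamma> / (1 + \<epsilon>)" "p * m2 = real \<gamma> / (1 - \<epsilon>)"
    using p assms by (auto simp: m1_def m2_def)
  let ?B1 = "{\<omega>\<in>space M. partial_sum (nat \<lfloor>m1\<rfloor>) \<omega> \<ge> real \<gamma>}"
  let ?B2 = "{\<omega>\<in>space M. partial_sum (nat \<lceil>m2\<rceil> - 1) \<omega> \<le> real \<gamma> - 1}"
  \<comment> \<open>Passing to events about partial sums first makes the union bound act on
    measurable sets.\<close>
  have "AE \<omega> in M. \<omega> \<in> {\<omega>\<in>space M. \<bar>(p_tilde X \<gamma> \<omega> - p) / p\<bar> \<ge> \<epsilon>} \<longrightarrow> \<omega> \<in> ?B1 \<union> ?B2"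
    using AE_partial_sum_le_if_sample_size_ge[OF m(2), of \<gamma>]
      AE_partial_sum_ge_if_sample_size_le[of \<gamma> m1]
  proof eventually_elim
    case (elim \<omega>)
    then show ?case
      using sample_size_of_relative_error[OF assms, of \<omega>] unfolding m1_def m2_def by auto
  qed
  then have "\<P>(\<omega> in M. \<bar>(p_tilde X \<gamma> \<omega> - p) / p\<bar> \<ge> \<epsilon>) \<le> prob (?B1 \<union> ?B2)"
    by (intro finite_measure_mono_AE) auto
  also have "\<dots> \<le> prob ?B1 + prob ?B2"
    by (intro measure_Un_le) auto
  also have "prob ?B1 \<le> (1 + \<epsilon>) powr (- real \<gamma>) * exp ((1 + \<epsilon> - 1) * (real \<gamma> / (1 + \<epsilon>)))"
    using assms m by (intro order_trans[OF prob_partial_sum_ge exp_tilt]) auto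
  also have "prob ?B2 \<le> (1 - \<epsilon>) powr (- real \<gamma>) * exp ((1 - \<epsilon> - 1) * (real \<gamma> / (1 - \<epsilon>)))"
    using assms m by (intro order_trans[OF prob_partial_sum_le exp_tilt]) auto
  finally show ?thesis by (simp add: Q_def)
qed

end

theorem theorem2:
  fixes M :: "'a measure" and X :: "nat \<Rightarrow> 'a \<Rightarrow> real"
    and \<epsilon> p :: real and \<gamma> :: nat
  assumes "0 < \<epsilon>" and "\<epsilon> < 1"
    and "prob_space M"
    and "prob_space.indep_vars M (\<lambda>_. borel) X {1..}"
    and "0 < p" and "p < 1"
    and "\<And>i. i \<ge> 1 \<Longrightarrow> \<P>(\<omega> in M. X i \<omega> = 1) = p"
    and "\<And>i. i \<ge> 1 \<Longrightarrow> \<P>(\<omega> in M. X i \<omega> = 0) = 1 - p"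
    and "\<gamma> > 0"
  shows "\<P>(\<omega> in M. \<bar>(p_tilde X \<gamma> \<omega> - p) / p\<bar> \<ge> \<epsilon>) \<le> Q \<epsilon> (real \<gamma>)
    \<and> strict_antimono_on UNIV (Q \<epsilon>)
    \<and> (\<forall>\<delta>. 0 < \<delta> \<and> \<delta> < 1 \<longrightarrow>
         (\<exists>!g. Q \<epsilon> g = \<delta>)
       \<and> (\<forall>g. Q \<epsilon> g = \<delta> \<longrightarrow>
            max ((1 + \<epsilon>) * ln (1 / \<delta>) / ((1 + \<epsilon>) * ln (1 + \<epsilon>) - \<epsilon>))
                ((1 - \<epsilon>) * ln (2 / \<delta>) / ((1 - \<epsilon>) * ln (1 - \<epsilon>) + \<epsilon>)) < g
          \<and> g < gamma_tilde \<epsilon> \<delta>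
          \<and> gamma_tilde \<epsilon> \<delta> < (1 + \<epsilon>) * ln (2 / \<delta>) / ((1 + \<epsilon>) * ln (1 + \<epsilon>) - \<epsilon>)))
    \<and> (\<forall>\<rho>>0.
         \<P>(\<omega> in M. ereal_of_enat (sample_size X \<gamma> \<omega>) \<ge> ereal (real \<gamma> * (1 + \<rho>) / p))
         \<le> ((1 - p) / (1 - p + \<rho>)) powr ((1 - p + \<rho>) * (real \<gamma> / p))
            * (1 + \<rho>) powr ((1 + \<rho>) * (real \<gamma> / p)))
    \<and> (\<forall>\<rho>. 0 < \<rho> \<and> \<rho> < 1 - p \<longrightarrow>
         \<P>(\<omega> in M. ereal_of_enat (sample_size X \<gamma> \<omega>) \<le> ereal (real \<gamma> * (1 - \<rho>) / p))
         \<le> ((1 - p) / (1 - p - \<rho>)) powr ((1 - p - \<rho>) * (real \<gamma> / p))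
            * (1 - \<rho>) powr ((1 - \<rho>) * (real \<gamma> / p)))"
proof -
  interpret bernoulli_sequence M X p
    using assms(3-8) by (simp add: bernoulli_sequence_def bernoulli_sequence_axioms_def)
  have "max ((1 + \<epsilon>) * ln (1 / \<delta>) / ((1 + \<epsilon>) * ln (1 + \<epsilon>) - \<epsilon>))
            ((1 - \<epsilon>) * ln (2 / \<delta>) / ((1 - \<epsilon>) * ln (1 - \<epsilon>) + \<epsilon>)) < g"
    and "g < gamma_tilde \<epsilon> \<delta>"
    and "gamma_tilde \<epsilon> \<delta> < (1 + \<epsilon>) * ln (2 / \<delta>) / ((1 + \<epsilon>) * ln (1 + \<epsilon>) - \<epsilon>)"
    if "0 < \<delta>" "\<delta> < 1" "Q \<epsilon> g = \<delta>" for \<delta> g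
    using Q_eq_lower_bounds[OF assms(1,2) that] less_gamma_tilde[OF assms(1,2) that]
      gamma_tilde_less_gamma_upper[OF assms(1,2) that(1,2)] divide_rate[of \<epsilon>] divide_rate[of "- \<epsilon>"] assms(1,2)
    by (auto simp: gamma_upper_def)
  moreover have "\<P>(\<omega> in M. ereal_of_enat (sample_size X \<gamma> \<omega>) \<ge> ereal (real \<gamma> * (1 + \<rho>) / p))
      \<le> ((1 - p) / (1 - p + \<rho>)) powr ((1 - p + \<rho>) * (real \<gamma> / p))
         * (1 + \<rho>) powr ((1 + \<rho>) * (real \<gamma> / p))" if "\<rho> > 0" for \<rho>
    using prob_sample_size_ge[of "(1 - p) / (1 - p + \<rho>)" "real \<gamma> * (1 + \<rho>) / p" \<gamma>]
      optimal_tilt[of \<rho> \<gamma>] that p assms(9) by (simp add: add_pos_pos)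
  moreover have "\<P>(\<omega> in M. ereal_of_enat (sample_size X \<gamma> \<omega>) \<le> ereal (real \<gamma> * (1 - \<rho>) / p))
      \<le> ((1 - p) / (1 - p - \<rho>)) powr ((1 - p - \<rho>) * (real \<gamma> / p))
         * (1 - \<rho>) powr ((1 - \<rho>) * (real \<gamma> / p))" if "0 < \<rho>" "\<rho> < 1 - p" for \<rho>
    \<comment> \<open>The assumption \<open>\<rho> < 1 - p\<close> keeps the denominator of the tilt
      positive; the tilt then exceeds 1, as the upper tail of the sum requires.\<close>
    using prob_sample_size_le[of "(1 - p) / (1 - p - \<rho>)" "real \<gamma> * (1 - \<rho>) / p" \<gamma>]
      optimal_tilt[of "- \<rho>" \<gamma>] that p by simp
  ultimately show ?thesis
    using prob_relative_error[OF assms(1,2,9)] Q_strict_antimono[OF assms(1,2)] ex1_Q_eq[OF assms(1,2)]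
    by blast
qed

end
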